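(* The class of finite conservative commutative residuated lattices is precisely the class of Catalan algebras (classes being understood up to isomorphism).
   Context: A commutative residuated lattice is an algebra $\mathbf A=\langle A,\wedge,\vee,\cdot,\to,\mathrm e\rangle$ such that $\langle A,\wedge,\vee\rangle$ is a lattice, $\langle A,\cdot,\mathrm e\rangle$ is a commutative monoid, and $ab\le c\iff b\le a\to c$ for all $a,b,c\in A$. It is conservative if $ab\in\{a,b\}$ for all $a,b$. Its monoidal order is $x\sqsubseteq y$ iff $xy=x$; in the commutative conservative case this is a total order with greatest element $\mathrm e$, and it determines the product ($xy$ is the $\sqsubseteq$-meet of $x$ and $y$). For finite $\mathbf A$, $\bot^{\mathbf A}$ is the least element of the lattice. Catalan sum: for finite commutative conservative residuated lattices $\mathbf A,\mathbf B$, the algebra $\mathbf C=\mathbf A\,\copyright\,\mathbf B$ has as universe $C$ the disjoint union of $A$ and $B$, with lattice order $${\le^{\mathbf C}}={\le^{\mathbf A}}\cup{\le^{\mathbf B}}\cup(\{\bot^{\mathbf A}\}\times B)\cup(A\times{\uparrow}\mathrm e^{\mathbf B}),\qquad {\uparrow}\mathrm e^{\mathbf B}=\{b\in B:\mathrm e^{\mathbf B}\le^{\mathbf B} b\},$$ and monoidal order $${\sqsubseteq^{\mathbf C}}={\sqsubseteq^{\mathbf A}}\cup{\sqsubseteq^{\mathbf B}}\cup(\{\bot^{\mathbf A}\}\times B)\cup(B\times(A\setminus\{\bot^{\mathbf A}\})),$$ where $\{\bot^{\mathbf A}\}\times B$ etc. are sets of pairs in the relation. The product of $\mathbf C$ is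 the meet of the total order $\sqsubseteq^{\mathbf C}$, the identity is its greatest element (so $\mathrm e^{\mathbf C}=\mathrm e^{\mathbf A}$ if $|A|>1$ and $\mathrm e^{\mathbf C}=\mathrm e^{\mathbf B}$ otherwise), and $\to$ is the residual of the product, $x\to y=\max\{z: xz\le^{\mathbf C} y\}$. An algebra is Catalan if it is a one-element algebra (in the language of residuated lattices) or is a Catalan sum of Catalan algebras; that is, the class of Catalan algebras is the smallest class, closed under isomorphism, containing the one-element algebra and closed under $\copyright$. *)

theory Defs
  imports "HOL-Algebra.Group"
begin

text \<open>
  Algebras \<open>\<langle>A, \<and>, \<or>, \<cdot>, \<rightarrow>, e\<rangle>\<close> in the language of residuated lattices are records extending the
  record of monoids. As usual in HOL-Algebra, only the values of the operations on the carrier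
  are meaningful.
\<close>

record 'a rlat = "'a monoid" +
  rmeet :: "['a, 'a] \<Rightarrow> 'a"
  rjoin :: "['a, 'a] \<Rightarrow> 'a"
  rimp  :: "['a, 'a] \<Rightarrow> 'a"

definition lat_rel :: "'a rlat \<Rightarrow> ('a \<times> 'a) set" where
  "lat_rel A = {(x, y). x \<in> carrier A \<and> y \<in> carrier A \<and> rmeet A x y = x}"

definition mon_rel :: "'a rlat \<Rightarrow> ('a \<times> 'a) set" where
  "mon_rel A = {(x, y). x \<in> carrier A \<and> y \<in> carrier A \<and> x \<otimes>\<^bsub>A\<^esub> y = x}"

locale comm_residuated_lattice = comm_monoid A for A :: "'a rlat" (structure) +
  assumes rmeet_closed: "\<lbrakk>x \<in> carrier A; y \<in> carrier A\<rbrakk> \<Longrightarrow> rmeet A x y \<in> carrier A"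
    and rjoin_closed: "\<lbrakk>x \<in> carrier A; y \<in> carrier A\<rbrakk> \<Longrightarrow> rjoin A x y \<in> carrier A"
    and rimp_closed: "\<lbrakk>x \<in> carrier A; y \<in> carrier A\<rbrakk> \<Longrightarrow> rimp A x y \<in> carrier A"
    and rmeet_comm: "\<lbrakk>x \<in> carrier A; y \<in> carrier A\<rbrakk> \<Longrightarrow> rmeet A x y = rmeet A y x"
    and rjoin_comm: "\<lbrakk>x \<in> carrier A; y \<in> carrier A\<rbrakk> \<Longrightarrow> rjoin A x y = rjoin A y x"
    and rmeet_assoc: "\<lbrakk>x \<in> carrier A; y \<in> carrier A; z \<in> carrier A\<rbrakk>
          \<Longrightarrow> rmeet A (rmeet A x y) z = rmeet A x (rmeet A y z)"
    and rjoin_assoc: "\<lbrakk>x \<in> carrier A; y \<in> carrier A; z \<in> carrier A\<rbrakk>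
          \<Longrightarrow> rjoin A (rjoin A x y) z = rjoin A x (rjoin A y z)"
    and rmeet_absorb: "\<lbrakk>x \<in> carrier A; y \<in> carrier A\<rbrakk> \<Longrightarrow> rmeet A x (rjoin A x y) = x"
    and rjoin_absorb: "\<lbrakk>x \<in> carrier A; y \<in> carrier A\<rbrakk> \<Longrightarrow> rjoin A x (rmeet A x y) = x"
    and residuation: "\<lbrakk>a \<in> carrier A; b \<in> carrier A; c \<in> carrier A\<rbrakk>
          \<Longrightarrow> (a \<otimes> b, c) \<in> lat_rel A \<longleftrightarrow> (b, rimp A a c) \<in> lat_rel A"

definition conservative :: "'a rlat \<Rightarrow> bool" where
  "conservative A \<longleftrightarrow> (\<forall>a\<in>carrier A. \<forall>b\<in>carrier A. a \<otimes>\<^bsub>A\<^esub> b \<in> {a, b})"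

definition rlat_iso :: "'a rlat \<Rightarrow> 'b rlat \<Rightarrow> bool" where
  "rlat_iso A B \<longleftrightarrow> (\<exists>h. bij_betw h (carrier A) (carrier B) \<and> h \<one>\<^bsub>A\<^esub> = \<one>\<^bsub>B\<^esub> \<and>
     (\<forall>x\<in>carrier A. \<forall>y\<in>carrier A.
        h (x \<otimes>\<^bsub>A\<^esub> y) = h x \<otimes>\<^bsub>B\<^esub> h y \<and>
        h (rmeet A x y) = rmeet B (h x) (h y) \<and>
        h (rjoin A x y) = rjoin B (h x) (h y) \<and>
        h (rimp A x y) = rimp B (h x) (h y)))"

definition one_element_algebra :: "'a rlat \<Rightarrow> bool" where
  "one_element_algebra A \<longleftrightarrow> (\<exists>a. carrier A = {a} \<and> \<one>\<^bsub>A\<^esub> = a \<and> a \<otimes>\<^bsub>A\<^esub> a = a \<and>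
     rmeet A a a = a \<and> rjoin A a a = a \<and> rimp A a a = a)"

definition ord_of :: "'a set \<Rightarrow> ('a \<times> 'a) set \<Rightarrow> 'a gorder" where
  "ord_of S r = \<lparr>carrier = S, eq = (=), le = (\<lambda>x y. (x, y) \<in> r)\<rparr>"

definition rbot :: "'a rlat \<Rightarrow> 'a" where
  "rbot A = \<bottom>\<^bsub>ord_of (carrier A) (lat_rel A)\<^esub>"

definition catalan_sum_le :: "'a rlat \<Rightarrow> 'b rlat \<Rightarrow> (('a + 'b) \<times> ('a + 'b)) set" where
  "catalan_sum_le A B =
     map_prod Inl Inl ` lat_rel A \<union> map_prod Inr Inr ` lat_rel B \<union>
     {Inl (rbot A)} \<times> Inr ` carrier B \<union>
     Inl ` carrier A \<times> Inr ` {b \<in> carrier B. (\<one>\<^bsub>B\<^esub>, b) \<in> lat_rel B}"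

definition catalan_sum_mon :: "'a rlat \<Rightarrow> 'b rlat \<Rightarrow> (('a + 'b) \<times> ('a + 'b)) set" where
  "catalan_sum_mon A B =
     map_prod Inl Inl ` mon_rel A \<union> map_prod Inr Inr ` mon_rel B \<union>
     {Inl (rbot A)} \<times> Inr ` carrier B \<union>
     Inr ` carrier B \<times> Inl ` (carrier A - {rbot A})"

definition catalan_sum :: "'a rlat \<Rightarrow> 'b rlat \<Rightarrow> ('a + 'b) rlat" where
  "catalan_sum A B =
     (let C = carrier A <+> carrier B;
          L = ord_of C (catalan_sum_le A B);
          M = ord_of C (catalan_sum_mon A B)
      in \<lparr>carrier = C,
          mult = (\<lambda>x y. x \<sqinter>\<^bsub>M\<^esub> y),
          one = \<top>\<^bsub>M\<^esub>,
          rmeet = (\<lambda>x y. x \<sqinter>\<^bsub>L\<^esub> y),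
          rjoin = (\<lambda>x y. x \<squnion>\<^bsub>L\<^esub> y),
          rimp = (\<lambda>x y. SOME w. greatest L w {z \<in> C. x \<sqinter>\<^bsub>M\<^esub> z \<sqsubseteq>\<^bsub>L\<^esub> y})\<rparr>)"

text \<open>
  Every finite algebra has an isomorphic copy with carrier in \<^typ>\<open>nat\<close>, so the smallest class closed
  under isomorphism and Catalan sums is generated inside that universe. The sum of two
  algebras over \<^typ>\<open>nat\<close> lives on \<^typ>\<open>nat + nat\<close>; \<open>sum\<close> admits all its copies over \<^typ>\<open>nat\<close>.
\<close>

inductive catalan_nat :: "nat rlat \<Rightarrow> bool" where
  one_element: "one_element_algebra A \<Longrightarrow> catalan_nat A"
| sum: "\<lbrakk>catalan_nat A; catalan_nat B; rlat_iso (catalan_sum A B) C\<rbrakk> \<Longrightarrow> catalan_nat C"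
| iso: "\<lbrakk>catalan_nat A; rlat_iso A B\<rbrakk> \<Longrightarrow> catalan_nat B"

definition catalan :: "'a rlat \<Rightarrow> bool" where
  "catalan A \<longleftrightarrow> (\<exists>N. catalan_nat N \<and> rlat_iso N A)"

end

theory Submission
  imports Defs
begin

text \<open>
  A finite conservative commutative residuated lattice is determined by its two orders, so it suffices
  to compare \<open>\<le>\<close> and \<open>\<sqsubseteq>\<close>. Given a nontrivial such algebra, let \<open>c\<close> be the \<open>\<sqsubseteq>\<close>-cover of the
  bottom element, \<open>U\<close> the lattice filter generated by \<open>c\<close>, and \<open>T\<close> its complement. Multiplying
  an inequality \<open>c \<le> x \<or> y\<close> by the \<open>\<sqsubseteq>\<close>-smaller of \<open>x\<close>, \<open>y\<close> shows that \<open>c\<close> is join prime, so \<open>T\<close>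
  is a lattice ideal. If \<open>u\<close> is the \<open>\<sqsubseteq>\<close>-greatest element of \<open>U\<close> and \<open>a \<in> T\<close> is not the bottom, then
  \<open>au = u\<close>, whence \<open>(a \<or> u)u = u\<close>; as \<open>u\<close> is an identity on \<open>U\<close> this gives \<open>a \<le> u\<close>, and \<open>a \<le> b \<in> U\<close>
  implies \<open>u = au \<le> bu = b\<close>. Hence the algebra is the Catalan sum of \<open>T\<close> and \<open>U\<close>, and
  induction on the cardinality applies.
\<close>

section \<open>Algebras built from a lattice order and a total monoidal order\<close>

definition rlat_of :: "'a set \<Rightarrow> ('a \<times> 'a) set \<Rightarrow> ('a \<times> 'a) set \<Rightarrow> 'a rlat" where
  "rlat_of S l m =
     (let L = ord_of S l; M = ord_of S m
      in \<lparr>carrier = S,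
          mult = (\<lambda>x y. x \<sqinter>\<^bsub>M\<^esub> y),
          one = \<top>\<^bsub>M\<^esub>,
          rmeet = (\<lambda>x y. x \<sqinter>\<^bsub>L\<^esub> y),
          rjoin = (\<lambda>x y. x \<squnion>\<^bsub>L\<^esub> y),
          rimp = (\<lambda>x y. SOME w. greatest L w {z \<in> S. x \<sqinter>\<^bsub>M\<^esub> z \<sqsubseteq>\<^bsub>L\<^esub> y})\<rparr>)"

text \<open>\<open>rlat_of\<close> abstracts the body of \<open>catalan_sum\<close> over the carrier
  and the two orders, so the Catalan sum and the restrictions below obtain their operations and laws
  from one construction.\<close>

lemma catalan_sum_eq:
  "catalan_sum A B = rlat_of (carrier A <+> carrier B) (catalan_sum_le A B) (catalan_sum_mon A B)"
  by (simp add: catalan_sum_def rlat_of_def Let_def)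

lemma ord_of_simps [simp]:
  "carrier (ord_of S r) = S"
  "x \<sqsubseteq>\<^bsub>ord_of S r\<^esub> y \<longleftrightarrow> (x, y) \<in> r"
  "x .=\<^bsub>ord_of S r\<^esub> y \<longleftrightarrow> x = y"
  by (simp_all add: ord_of_def)

lemma partial_order_ord_ofI:
  assumes "\<And>x. x \<in> S \<Longrightarrow> (x, x) \<in> r"
    and "\<And>x y. \<lbrakk>x \<in> S; y \<in> S; (x, y) \<in> r; (y, x) \<in> r\<rbrakk> \<Longrightarrow> x = y"
    and "\<And>x y z. \<lbrakk>x \<in> S; y \<in> S; z \<in> S; (x, y) \<in> r; (y, z) \<in> r\<rbrakk> \<Longrightarrow> (x, z) \<in> r"
  shows "partial_order (ord_of S r)"
proof
qed (auto simp: ord_of_def intro: assms)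

lemma lattice_ord_ofI:
  assumes po: "partial_order (ord_of S r)"
    and inf: "\<And>x y. \<lbrakk>x \<in> S; y \<in> S\<rbrakk> \<Longrightarrow>
      \<exists>w\<in>S. (w, x) \<in> r \<and> (w, y) \<in> r \<and> (\<forall>z\<in>S. (z, x) \<in> r \<longrightarrow> (z, y) \<in> r \<longrightarrow> (z, w) \<in> r)"
    and sup: "\<And>x y. \<lbrakk>x \<in> S; y \<in> S\<rbrakk> \<Longrightarrow>
      \<exists>w\<in>S. (x, w) \<in> r \<and> (y, w) \<in> r \<and> (\<forall>z\<in>S. (x, z) \<in> r \<longrightarrow> (y, z) \<in> r \<longrightarrow> (w, z) \<in> r)"
  shows "lattice (ord_of S r)"
proof -
  interpret partial_order "ord_of S r" by (rule po)
  show ?thesis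
  proof
    fix x y assume "x \<in> carrier (ord_of S r)" "y \<in> carrier (ord_of S r)"
    then show "\<exists>s. least (ord_of S r) s (Upper (ord_of S r) {x, y})"
      using sup[of x y] unfolding least_def Upper_def by auto
  next
    fix x y assume "x \<in> carrier (ord_of S r)" "y \<in> carrier (ord_of S r)"
    then show "\<exists>s. greatest (ord_of S r) s (Lower (ord_of S r) {x, y})"
      using inf[of x y] unfolding greatest_def Lower_def by auto
  qed
qed

lemma total_order_meet_eq:
  assumes "total_order (ord_of S m)" "x \<in> S" "y \<in> S"
  shows "x \<sqinter>\<^bsub>ord_of S m\<^esub> y = (if (x, y) \<in> m then x else y)"
proof -
  interpret M: total_order "ord_of S m" by (rule assms(1))
  have w: "(x \<sqinter>\<^bsub>ord_of S m\<^esub> y, x) \<in> m" "(x \<sqinter>\<^bsub>ord_of S m\<^esub> y, y) \<in> m" "x \<sqinter>\<^bsub>ord_of S m\<^esub> y \<in> S"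
    using assms(2,3) M.meet_left[of x y] M.meet_right[of x y] M.meet_closed[of x y] by simp_all
  show ?thesis
  proof (cases "(x, y) \<in> m")
    case True
    then have "(x, x \<sqinter>\<^bsub>ord_of S m\<^esub> y) \<in> m" using assms(2,3) M.meet_le[of x x y] M.le_refl[of x] by simp
    then show ?thesis using True w assms(2) M.le_antisym[of x "x \<sqinter>\<^bsub>ord_of S m\<^esub> y"] by simp
  next
    case False
    then have "(y, x) \<in> m" using assms(2,3) M.total_order_total[of x y] by simp
    then have "(y, x \<sqinter>\<^bsub>ord_of S m\<^esub> y) \<in> m" using assms(2,3) M.meet_le[of y x y] M.le_refl[of y] by simp
    then show ?thesis using False w assms(3) M.le_antisym[of y "x \<sqinter>\<^bsub>ord_of S m\<^esub> y"] by simp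
  qed
qed

lemma total_order_ord_ofI:
  assumes "partial_order (ord_of S r)" and "\<And>x y. \<lbrakk>x \<in> S; y \<in> S\<rbrakk> \<Longrightarrow> (x, y) \<in> r \<or> (y, x) \<in> r"
  shows "total_order (ord_of S r)"
  by (rule partial_order.total_orderI[OF assms(1)]) (use assms(2) in simp)

text \<open>Upper bounds of growing finite subsets are found inside \<open>T\<close>, one new
  element at a time. The relation is left general because the decomposition takes it to be
  \<open>\<le>\<close>, \<open>\<sqsubseteq>\<close> and the converse of
  \<open>\<sqsubseteq>\<close>.\<close>

lemma finite_directed_has_greatest:
  assumes "finite T" "T \<noteq> {}"
    and dir: "\<And>x y. \<lbrakk>x \<in> T; y \<in> T\<rbrakk> \<Longrightarrow> \<exists>z\<in>T. (x, z) \<in> r \<and> (y, z) \<in> r"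
    and trans: "\<And>x y z. \<lbrakk>(x, y) \<in> r; (y, z) \<in> r\<rbrakk> \<Longrightarrow> (x, z) \<in> r"
  shows "\<exists>t\<in>T. \<forall>x\<in>T. (x, t) \<in> r"
proof -
  have "\<exists>t\<in>T. \<forall>x\<in>F. (x, t) \<in> r" if "finite F" "F \<subseteq> T" for F
    using that
  proof (induction F)
    case empty
    then show ?case using \<open>T \<noteq> {}\<close> by blast
  next
    case (insert y F)
    then obtain t where t: "t \<in> T" "\<forall>x\<in>F. (x, t) \<in> r" by blast
    obtain z where "z \<in> T" "(t, z) \<in> r" "(y, z) \<in> r" using dir t(1) insert.prems by blast
    then show ?case using t trans by blast
  qed
  then show ?thesis using \<open>finite T\<close> by blast
qed

text \<open>The order data from which \<open>rlat_of\<close> produces a finite conservative algebra.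
  Totality of \<open>m\<close> makes its meet conservative, and \<open>residual_exists\<close> is
  residuation with the implication existentially quantified. The inclusions in
  \<open>S \<times> S\<close> let the algebra give back exactly \<open>l\<close> and
  \<open>m\<close> as its orders.\<close>

locale residuated_frame = L: lattice "ord_of S l" + M: total_order "ord_of S m"
  for S :: "'a set" and l m +
  assumes finite_S: "finite S" and nonempty_S: "S \<noteq> {}"
    and l_sub: "l \<subseteq> S \<times> S" and m_sub: "m \<subseteq> S \<times> S"
    and residual_exists: "\<lbrakk>x \<in> S; y \<in> S\<rbrakk> \<Longrightarrow>
      \<exists>w\<in>S. \<forall>z\<in>S. (x \<sqinter>\<^bsub>ord_of S m\<^esub> z, y) \<in> l \<longleftrightarrow> (z, w) \<in> l"

locale finite_conservative_crl = comm_residuated_lattice +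
  assumes conservative: "conservative A" and finite_carrier: "finite (carrier A)"

context residuated_frame
begin

lemmas meet_M_eq = total_order_meet_eq[OF M.total_order_axioms]

lemma le_iff_meet_L: "\<lbrakk>x \<in> S; y \<in> S\<rbrakk> \<Longrightarrow> (x, y) \<in> l \<longleftrightarrow> x \<sqinter>\<^bsub>ord_of S l\<^esub> y = x"
  using L.weak_le_iff_join[of x y] by auto

lemma top_M: "\<top>\<^bsub>ord_of S m\<^esub> \<in> S" and top_M_greatest: "x \<in> S \<Longrightarrow> (x, \<top>\<^bsub>ord_of S m\<^esub>) \<in> m"
proof -
  \<comment> \<open>The top is a choice of a greatest element, so one has to be exhibited first: the
    supremum of the finite nonempty set \<open>S\<close>.\<close>
  have "least (ord_of S m) (\<Squnion>\<^bsub>ord_of S m\<^esub> S) (Upper (ord_of S m) S)"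
    using M.finite_sup_least[of S] finite_S nonempty_S by auto
  then have "greatest (ord_of S m) (\<Squnion>\<^bsub>ord_of S m\<^esub> S) S"
    by (auto simp: greatest_def least_def Upper_def)
  then have "greatest (ord_of S m) (\<top>\<^bsub>ord_of S m\<^esub>) S"
    unfolding top_def ord_of_simps by (rule someI)
  then show "\<top>\<^bsub>ord_of S m\<^esub> \<in> S" "x \<in> S \<Longrightarrow> (x, \<top>\<^bsub>ord_of S m\<^esub>) \<in> m"
    by (auto simp: greatest_def)
qed

text \<open>Together with \<open>mon_rel_rlat_of\<close>: the algebra remembers both orders, so
  questions about a Catalan sum or a restriction can be settled at the level of relations.\<close>

lemma lat_rel_rlat_of: "lat_rel (rlat_of S l m) = l"
  using l_sub le_iff_meet_L by (auto simp: lat_rel_def rlat_of_def Let_def)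

lemma mon_rel_rlat_of: "mon_rel (rlat_of S l m) = m"
  using m_sub M.total_order_total M.le_antisym M.le_refl
  by (auto simp: mon_rel_def rlat_of_def Let_def meet_M_eq split: if_splits)

lemma carrier_rlat_of: "carrier (rlat_of S l m) = S"
  by (simp add: rlat_of_def Let_def)

text \<open>The lattice laws come from \<open>L\<close>. In the chain \<open>M\<close> the meet is
  associative, commutative and conservative, with the top as identity. Residuation is what takes
  work, because \<open>rimp\<close> is a choice.\<close>

lemma finite_conservative_crl_rlat_of: "finite_conservative_crl (rlat_of S l m)"
proof -
  let ?A = "rlat_of S l m"
  \<comment> \<open>The residual \<open>w\<close> belongs to the set since \<open>w \<le> w\<close>,
    and it bounds the set, so the choice in \<open>rimp\<close> does pick a greatest
    element.\<close>
  have imp: "greatest (ord_of S l) (rimp ?A x y) {z \<in> S. (x \<sqinter>\<^bsub>ord_of S m\<^esub> z, y) \<in> l}"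
    if xy: "x \<in> S" "y \<in> S" for x y
  proof -
    obtain w where "w \<in> S" "\<forall>z\<in>S. (x \<sqinter>\<^bsub>ord_of S m\<^esub> z, y) \<in> l \<longleftrightarrow> (z, w) \<in> l"
      using residual_exists xy by blast
    then have "greatest (ord_of S l) w {z \<in> S. (x \<sqinter>\<^bsub>ord_of S m\<^esub> z, y) \<in> l}"
      using L.le_refl[of w] by (auto simp: greatest_def)
    then show ?thesis
      unfolding rlat_of_def Let_def ord_of_simps rlat.simps by (rule someI)
  qed
  \<comment> \<open>Being greatest does not by itself say that everything below it belongs to the
    set. Antisymmetry identifies \<open>rimp\<close> with the witness \<open>w\<close>, for which
    the full equivalence is known.\<close>
  have res: "(a \<sqinter>\<^bsub>ord_of S m\<^esub> b, c) \<in> l \<longleftrightarrow> (b, rimp ?A a c) \<in> l"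
    if "a \<in> S" "b \<in> S" "c \<in> S" for a b c
  proof -
    obtain w where w: "w \<in> S" "\<forall>z\<in>S. (a \<sqinter>\<^bsub>ord_of S m\<^esub> z, c) \<in> l \<longleftrightarrow> (z, w) \<in> l"
      using residual_exists \<open>a \<in> S\<close> \<open>c \<in> S\<close> by blast
    then have "rimp ?A a c = w"
      using imp[of a c] that L.le_refl[of w] L.le_antisym[of w "rimp ?A a c"]
      by (auto simp: greatest_def)
    then show ?thesis using w that by simp
  qed
  show ?thesis
  proof
    fix x y assume "x \<in> carrier ?A" "y \<in> carrier ?A"
    then have xy: "x \<in> S" "y \<in> S" by (simp_all add: carrier_rlat_of)
    show "x \<otimes>\<^bsub>?A\<^esub> y \<in> carrier ?A" "rmeet ?A x y \<in> carrier ?A" "rjoin ?A x y \<in> carrier ?A"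
      "rmeet ?A x y = rmeet ?A y x" "rjoin ?A x y = rjoin ?A y x" "x \<otimes>\<^bsub>?A\<^esub> y = y \<otimes>\<^bsub>?A\<^esub> x"
      using xy M.meet_closed[of x y] L.meet_closed[of x y] L.join_closed[of x y]
        meet_comm[of "ord_of S l" x y] meet_comm[of "ord_of S m" x y] join_comm[of "ord_of S l" x y]
      by (simp_all add: rlat_of_def Let_def)
    show "rimp ?A x y \<in> carrier ?A" using imp[OF xy] by (simp add: greatest_def carrier_rlat_of)
    show "rmeet ?A x (rjoin ?A x y) = x"
      using xy L.join_closed[of x y] L.join_left[of x y] le_iff_meet_L[of x "x \<squnion>\<^bsub>ord_of S l\<^esub> y"]
      by (simp add: rlat_of_def Let_def)
    have "(x \<sqinter>\<^bsub>ord_of S l\<^esub> y, x) \<in> l" using xy L.meet_left[of x y] by simp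
    then show "rjoin ?A x (rmeet ?A x y) = x"
      using xy L.meet_closed[of x y] L.weak_le_iff_meet[of "x \<sqinter>\<^bsub>ord_of S l\<^esub> y" x]
      by (simp add: rlat_of_def Let_def join_comm[of "ord_of S l" x])
  next
    fix x y z assume "x \<in> carrier ?A" "y \<in> carrier ?A" "z \<in> carrier ?A"
    then have xyz: "x \<in> S" "y \<in> S" "z \<in> S" by (simp_all add: carrier_rlat_of)
    then show "x \<otimes>\<^bsub>?A\<^esub> y \<otimes>\<^bsub>?A\<^esub> z = x \<otimes>\<^bsub>?A\<^esub> (y \<otimes>\<^bsub>?A\<^esub> z)"
      "rmeet ?A (rmeet ?A x y) z = rmeet ?A x (rmeet ?A y z)"
      "rjoin ?A (rjoin ?A x y) z = rjoin ?A x (rjoin ?A y z)"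
      using M.weak_meet_assoc[of x y z] L.weak_meet_assoc[of x y z] L.weak_join_assoc[of x y z]
      by (simp_all add: rlat_of_def Let_def)
    show "(x \<otimes>\<^bsub>?A\<^esub> y, z) \<in> lat_rel ?A \<longleftrightarrow> (y, rimp ?A x z) \<in> lat_rel ?A"
      unfolding lat_rel_rlat_of using res[OF xyz] by (simp add: rlat_of_def Let_def)
  next
    show "\<one>\<^bsub>?A\<^esub> \<in> carrier ?A" using top_M by (simp add: rlat_of_def Let_def)
  next
    fix x assume "x \<in> carrier ?A"
    then show "\<one>\<^bsub>?A\<^esub> \<otimes>\<^bsub>?A\<^esub> x = x"
      using top_M top_M_greatest[of x] M.le_antisym[of x "\<top>\<^bsub>ord_of S m\<^esub>"]
      by (auto simp: rlat_of_def Let_def meet_M_eq)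
    then show "x \<otimes>\<^bsub>?A\<^esub> \<one>\<^bsub>?A\<^esub> = x"
      by (simp add: rlat_of_def Let_def meet_comm[of "ord_of S m" x])
  next
    show "conservative ?A" by (simp add: conservative_def rlat_of_def Let_def meet_M_eq)
    show "finite (carrier ?A)" by (simp add: carrier_rlat_of finite_S)
  qed
qed

end

section \<open>The two orders of a finite conservative algebra\<close>

context finite_conservative_crl
begin

lemma mult_cases: "\<lbrakk>x \<in> carrier A; y \<in> carrier A\<rbrakk> \<Longrightarrow> x \<otimes> y = x \<or> x \<otimes> y = y"
  using conservative by (auto simp: conservative_def)

lemma le_carrier: "(x, y) \<in> lat_rel A \<Longrightarrow> x \<in> carrier A \<and> y \<in> carrier A"
  by (simp add: lat_rel_def)

lemma rmeet_idem: "x \<in> carrier A \<Longrightarrow> rmeet A x x = x"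
  by (metis rmeet_absorb rmeet_closed rjoin_absorb)

lemma le_refl: "x \<in> carrier A \<Longrightarrow> (x, x) \<in> lat_rel A"
  by (simp add: lat_rel_def rmeet_idem)

lemma le_antisym: "\<lbrakk>(x, y) \<in> lat_rel A; (y, x) \<in> lat_rel A\<rbrakk> \<Longrightarrow> x = y"
  using rmeet_comm[of x y] by (auto simp: lat_rel_def)

lemma le_trans: "\<lbrakk>(x, y) \<in> lat_rel A; (y, z) \<in> lat_rel A\<rbrakk> \<Longrightarrow> (x, z) \<in> lat_rel A"
  using rmeet_assoc[of x y z] by (auto simp: lat_rel_def)

lemma le_iff_rjoin: "\<lbrakk>x \<in> carrier A; y \<in> carrier A\<rbrakk> \<Longrightarrow> (x, y) \<in> lat_rel A \<longleftrightarrow> rjoin A x y = y"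
  by (auto simp: lat_rel_def) (metis rjoin_absorb rjoin_comm rmeet_comm, metis rmeet_absorb)

lemma rmeet_le:
  assumes "x \<in> carrier A" "y \<in> carrier A"
  shows "(rmeet A x y, x) \<in> lat_rel A" "(rmeet A x y, y) \<in> lat_rel A"
  using assms rmeet_closed[OF assms]
  by (simp_all add: lat_rel_def) (metis rmeet_assoc rmeet_comm rmeet_idem, metis rmeet_assoc rmeet_idem)

lemma rmeet_greatest:
  "\<lbrakk>(z, x) \<in> lat_rel A; (z, y) \<in> lat_rel A\<rbrakk> \<Longrightarrow> (z, rmeet A x y) \<in> lat_rel A"
  using rmeet_assoc[of z x y] rmeet_closed by (auto simp: lat_rel_def)

lemma rjoin_ge:
  assumes "x \<in> carrier A" "y \<in> carrier A"
  shows "(x, rjoin A x y) \<in> lat_rel A" "(y, rjoin A x y) \<in> lat_rel A"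
  using assms rjoin_closed[OF assms] rmeet_absorb[of x y] rmeet_absorb[of y x] rjoin_comm[of x y]
  by (simp_all add: lat_rel_def)

lemma rjoin_least:
  assumes "(x, z) \<in> lat_rel A" "(y, z) \<in> lat_rel A"
  shows "(rjoin A x y, z) \<in> lat_rel A"
proof -
  have "x \<in> carrier A" "y \<in> carrier A" "z \<in> carrier A" using assms le_carrier by auto
  then show ?thesis
    using assms rjoin_assoc[of x y z] by (simp add: le_iff_rjoin rjoin_closed)
qed

lemma mon_refl: "x \<in> carrier A \<Longrightarrow> (x, x) \<in> mon_rel A"
  using mult_cases[of x x] by (simp add: mon_rel_def)

lemma mon_antisym: "\<lbrakk>(x, y) \<in> mon_rel A; (y, x) \<in> mon_rel A\<rbrakk> \<Longrightarrow> x = y"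
  using m_comm[of x y] by (auto simp: mon_rel_def)

lemma mon_trans: "\<lbrakk>(x, y) \<in> mon_rel A; (y, z) \<in> mon_rel A\<rbrakk> \<Longrightarrow> (x, z) \<in> mon_rel A"
  using m_assoc[of x y z] by (auto simp: mon_rel_def)

lemma mon_total: "\<lbrakk>x \<in> carrier A; y \<in> carrier A\<rbrakk> \<Longrightarrow> (x, y) \<in> mon_rel A \<or> (y, x) \<in> mon_rel A"
  using mult_cases[of x y] m_comm[of x y] by (auto simp: mon_rel_def)

lemma mult_eq_if: "\<lbrakk>x \<in> carrier A; y \<in> carrier A\<rbrakk> \<Longrightarrow> x \<otimes> y = (if (x, y) \<in> mon_rel A then x else y)"
  using mult_cases[of x y] by (auto simp: mon_rel_def)

lemma mon_one: "x \<in> carrier A \<Longrightarrow> (x, \<one>) \<in> mon_rel A"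
  by (simp add: mon_rel_def)

lemma lattice_ord_of_lat_rel: "lattice (ord_of (carrier A) (lat_rel A))"
proof (rule lattice_ord_ofI)
  show "partial_order (ord_of (carrier A) (lat_rel A))"
    by (rule partial_order_ord_ofI) (blast intro: le_refl le_antisym le_trans)+
qed (meson rmeet_closed rmeet_le rmeet_greatest rjoin_closed rjoin_ge rjoin_least)+

lemma rbot_closed: "rbot A \<in> carrier A" and rbot_le: "x \<in> carrier A \<Longrightarrow> (rbot A, x) \<in> lat_rel A"
proof -
  let ?L = "ord_of (carrier A) (lat_rel A)"
  interpret L: lattice ?L by (rule lattice_ord_of_lat_rel)
  have "greatest ?L (\<Sqinter>\<^bsub>?L\<^esub> carrier A) (Lower ?L (carrier A))"
    using L.finite_inf_greatest[of "carrier A"] finite_carrier one_closed by auto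
  then have "least ?L (\<Sqinter>\<^bsub>?L\<^esub> carrier A) (carrier A)"
    by (auto simp: greatest_def least_def Lower_def)
  then have "least ?L (rbot A) (carrier A)"
    unfolding rbot_def bottom_def ord_of_simps by (rule someI)
  then show "rbot A \<in> carrier A" "x \<in> carrier A \<Longrightarrow> (rbot A, x) \<in> lat_rel A"
    by (auto simp: least_def)
qed

lemma le_rbot_iff: "x \<in> carrier A \<Longrightarrow> (x, rbot A) \<in> lat_rel A \<longleftrightarrow> x = rbot A"
  using le_antisym rbot_le le_refl by blast

text \<open>Residuating \<open>\<bottom> \<le> x \<rightarrow> \<bottom>\<close> gives
  \<open>x\<bottom> \<le> \<bottom>\<close>. So the bottom is absorbing, and both orders have the
  same least element.\<close>

lemma mon_rbot: "x \<in> carrier A \<Longrightarrow> (rbot A, x) \<in> mon_rel A"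
proof -
  assume x: "x \<in> carrier A"
  have "(rbot A, rimp A x (rbot A)) \<in> lat_rel A"
    using x rbot_closed rimp_closed rbot_le by blast
  then have "(x \<otimes> rbot A, rbot A) \<in> lat_rel A"
    using x rbot_closed residuation by blast
  then have "x \<otimes> rbot A = rbot A"
    using x rbot_closed le_rbot_iff by simp
  then show ?thesis using x rbot_closed m_comm[of x "rbot A"] by (simp add: mon_rel_def)
qed

lemma mon_rbot_iff: "x \<in> carrier A \<Longrightarrow> (x, rbot A) \<in> mon_rel A \<longleftrightarrow> x = rbot A"
  using mon_antisym mon_rbot mon_refl by blast

text \<open>Conservativity makes the product the meet of the total order \<open>mon_rel A\<close>,
  and \<open>rimp A\<close> supplies the residuals. This is the counterpart of
  \<open>finite_conservative_crl_rlat_of\<close>.\<close>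

lemma residuated_frame: "residuated_frame (carrier A) (lat_rel A) (mon_rel A)"
proof -
  let ?S = "carrier A" and ?l = "lat_rel A" and ?m = "mon_rel A"
  interpret L: lattice "ord_of ?S ?l" by (rule lattice_ord_of_lat_rel)
  interpret M: total_order "ord_of ?S ?m"
  proof (rule total_order_ord_ofI)
    show "partial_order (ord_of ?S ?m)"
      by (rule partial_order_ord_ofI) (blast intro: mon_refl mon_antisym mon_trans)+
  qed (rule mon_total)
  have mult: "x \<sqinter>\<^bsub>ord_of ?S ?m\<^esub> y = x \<otimes> y" if "x \<in> ?S" "y \<in> ?S" for x y
    using that total_order_meet_eq[OF M.total_order_axioms] by (simp add: mult_eq_if)
  show ?thesis
  proof
    fix x y assume xy: "x \<in> ?S" "y \<in> ?S"
    then show "\<exists>w\<in>?S. \<forall>z\<in>?S. (x \<sqinter>\<^bsub>ord_of ?S ?m\<^esub> z, y) \<in> ?l \<longleftrightarrow> (z, w) \<in> ?l"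
      using residuation rimp_closed by (intro bexI[of _ "rimp A x y"]) (auto simp: mult)
  qed (use finite_carrier one_closed in \<open>auto simp: lat_rel_def mon_rel_def\<close>)
qed

section \<open>Universal characterisations of the operations, and isomorphisms\<close>

lemma rbot_eqI:
  assumes "b \<in> carrier A" "\<And>x. x \<in> carrier A \<Longrightarrow> (b, x) \<in> lat_rel A"
  shows "rbot A = b"
  using assms rbot_closed rbot_le le_antisym by blast

lemma one_eqI:
  assumes "u \<in> carrier A" "\<And>x. x \<in> carrier A \<Longrightarrow> (x, u) \<in> mon_rel A"
  shows "\<one> = u"
  using assms one_closed mon_one mon_antisym by blast

lemma rmeet_eqI:
  assumes "x \<in> carrier A" "y \<in> carrier A" "(w, x) \<in> lat_rel A" "(w, y) \<in> lat_rel A"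
    and "\<And>z. \<lbrakk>(z, x) \<in> lat_rel A; (z, y) \<in> lat_rel A\<rbrakk> \<Longrightarrow> (z, w) \<in> lat_rel A"
  shows "rmeet A x y = w"
  by (rule le_antisym) (simp_all add: assms rmeet_le rmeet_greatest)

lemma rjoin_eqI:
  assumes "x \<in> carrier A" "y \<in> carrier A" "(x, w) \<in> lat_rel A" "(y, w) \<in> lat_rel A"
    and "\<And>z. \<lbrakk>(x, z) \<in> lat_rel A; (y, z) \<in> lat_rel A\<rbrakk> \<Longrightarrow> (w, z) \<in> lat_rel A"
  shows "rjoin A x y = w"
  by (rule le_antisym) (simp_all add: assms rjoin_ge rjoin_least)

lemma rimp_eqI:
  assumes "x \<in> carrier A" "y \<in> carrier A" "w \<in> carrier A"
    and "\<And>z. z \<in> carrier A \<Longrightarrow> (x \<otimes> z, y) \<in> lat_rel A \<longleftrightarrow> (z, w) \<in> lat_rel A"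
  shows "rimp A x y = w"
  using assms residuation[of x "rimp A x y" y] residuation[of x w y]
  by (intro le_antisym) (simp_all add: rimp_closed le_refl)

end

text \<open>Each operation is characterised by the two orders through the uniqueness rules above.
  Surjectivity pulls the test elements \<open>z\<close> of those rules back to \<open>A\<close>,
  where the corresponding property holds.\<close>

lemma rlat_isoI:
  assumes "finite_conservative_crl A" "finite_conservative_crl B"
    and bij: "bij_betw h (carrier A) (carrier B)"
    and l: "\<And>x y. \<lbrakk>x \<in> carrier A; y \<in> carrier A\<rbrakk> \<Longrightarrow> (h x, h y) \<in> lat_rel B \<longleftrightarrow> (x, y) \<in> lat_rel A"
    and m: "\<And>x y. \<lbrakk>x \<in> carrier A; y \<in> carrier A\<rbrakk> \<Longrightarrow> (h x, h y) \<in> mon_rel B \<longleftrightarrow> (x, y) \<in> mon_rel A"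
  shows "rlat_iso A B"
proof -
  interpret A: finite_conservative_crl A by fact
  interpret B: finite_conservative_crl B by fact
  have h: "h x \<in> carrier B" if "x \<in> carrier A" for x using bij that by (rule bij_betw_apply)
  have surj: "\<exists>x\<in>carrier A. z = h x" if "z \<in> carrier B" for z
    using bij that by (auto simp: bij_betw_def)
  have mult: "h (x \<otimes>\<^bsub>A\<^esub> y) = h x \<otimes>\<^bsub>B\<^esub> h y" if "x \<in> carrier A" "y \<in> carrier A" for x y
    using that h by (simp add: A.mult_eq_if B.mult_eq_if m)
  have "\<one>\<^bsub>B\<^esub> = h \<one>\<^bsub>A\<^esub>"
    using surj A.mon_one m h by (intro B.one_eqI) fastforce+
  moreover have "rmeet B (h x) (h y) = h (rmeet A x y)" if xy: "x \<in> carrier A" "y \<in> carrier A" for x y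
  proof (rule B.rmeet_eqI)
    fix z assume z: "(z, h x) \<in> lat_rel B" "(z, h y) \<in> lat_rel B"
    then obtain z' where "z' \<in> carrier A" "z = h z'" using surj B.le_carrier by blast
    then show "(z, h (rmeet A x y)) \<in> lat_rel B"
      using z xy by (simp add: l A.rmeet_greatest A.rmeet_closed)
  qed (use xy in \<open>simp_all add: h l A.rmeet_le A.rmeet_closed\<close>)
  moreover have "rjoin B (h x) (h y) = h (rjoin A x y)" if xy: "x \<in> carrier A" "y \<in> carrier A" for x y
  proof (rule B.rjoin_eqI)
    fix z assume z: "(h x, z) \<in> lat_rel B" "(h y, z) \<in> lat_rel B"
    then obtain z' where "z' \<in> carrier A" "z = h z'" using surj B.le_carrier by blast
    then show "(h (rjoin A x y), z) \<in> lat_rel B"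
      using z xy by (simp add: l A.rjoin_least A.rjoin_closed)
  qed (use xy in \<open>simp_all add: h l A.rjoin_ge A.rjoin_closed\<close>)
  moreover have "rimp B (h x) (h y) = h (rimp A x y)" if xy: "x \<in> carrier A" "y \<in> carrier A" for x y
  proof (rule B.rimp_eqI)
    fix z assume "z \<in> carrier B"
    then obtain z' where "z' \<in> carrier A" "z = h z'" using surj by blast
    then show "(h x \<otimes>\<^bsub>B\<^esub> z, h y) \<in> lat_rel B \<longleftrightarrow> (z, h (rimp A x y)) \<in> lat_rel B"
      using xy by (simp add: l A.residuation A.rimp_closed flip: mult)
  qed (use xy in \<open>simp_all add: h A.rimp_closed\<close>)
  ultimately show ?thesis
    unfolding rlat_iso_def using bij mult by (intro exI[of _ h]) simp
qed

lemma finite_conservative_crl_iso: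
  assumes "rlat_iso A B" "finite_conservative_crl A"
  shows "finite_conservative_crl B"
proof -
  interpret A: finite_conservative_crl A by fact
  obtain h where bij: "bij_betw h (carrier A) (carrier B)" and one: "h \<one>\<^bsub>A\<^esub> = \<one>\<^bsub>B\<^esub>"
    and hom: "\<forall>x\<in>carrier A. \<forall>y\<in>carrier A.
        h (x \<otimes>\<^bsub>A\<^esub> y) = h x \<otimes>\<^bsub>B\<^esub> h y \<and>
        h (rmeet A x y) = rmeet B (h x) (h y) \<and>
        h (rjoin A x y) = rjoin B (h x) (h y) \<and>
        h (rimp A x y) = rimp B (h x) (h y)"
    using assms(1) unfolding rlat_iso_def by blast
  have ops: "h x \<otimes>\<^bsub>B\<^esub> h y = h (x \<otimes>\<^bsub>A\<^esub> y)" "rmeet B (h x) (h y) = h (rmeet A x y)"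
    "rjoin B (h x) (h y) = h (rjoin A x y)" "rimp B (h x) (h y) = h (rimp A x y)"
    if "x \<in> carrier A" "y \<in> carrier A" for x y
    using hom that by simp_all
  have img: "carrier B = h ` carrier A" and inj: "inj_on h (carrier A)"
    using bij by (auto simp: bij_betw_def)
  \<comment> \<open>The order is an equation between meets, so the homomorphism \<open>h\<close>
    preserves it and, being injective, reflects it. This is what carries residuation over to
    \<open>B\<close>.\<close>
  have l: "(h x, h y) \<in> lat_rel B \<longleftrightarrow> (x, y) \<in> lat_rel A" if "x \<in> carrier A" "y \<in> carrier A" for x y
    using that inj_on_eq_iff[OF inj A.rmeet_closed[OF that] that(1)] by (simp add: lat_rel_def img ops)
  show ?thesis
  proof
    show "conservative B"
      unfolding conservative_def img using A.mult_cases by (fastforce simp: ops)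
    show "finite (carrier B)" by (simp add: img A.finite_carrier)
    fix x y assume "x \<in> carrier B" "y \<in> carrier B"
    then show "x \<otimes>\<^bsub>B\<^esub> y = y \<otimes>\<^bsub>B\<^esub> x" "rmeet B x y = rmeet B y x" "rjoin B x y = rjoin B y x"
      by (auto simp: img ops A.m_comm A.rmeet_comm A.rjoin_comm)
  qed (auto simp: img ops l A.rmeet_closed A.rjoin_closed A.rimp_closed A.m_assoc
      A.rmeet_assoc A.rjoin_assoc A.rmeet_absorb A.rjoin_absorb A.residuation simp flip: one)
qed

section \<open>Residuation in the Catalan sum\<close>

lemma catalan_sum_le_simps:
  "(Inl x, Inl x') \<in> catalan_sum_le A B \<longleftrightarrow> (x, x') \<in> lat_rel A"
  "(Inr y, Inr y') \<in> catalan_sum_le A B \<longleftrightarrow> (y, y') \<in> lat_rel B"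
  "(Inl x, Inr y) \<in> catalan_sum_le A B \<longleftrightarrow>
     y \<in> carrier B \<and> (x = rbot A \<or> x \<in> carrier A \<and> (\<one>\<^bsub>B\<^esub>, y) \<in> lat_rel B)"
  "(Inr y, Inl x) \<notin> catalan_sum_le A B"
  by (auto simp: catalan_sum_le_def image_iff Bex_def Ball_def)

lemma catalan_sum_mon_simps:
  "(Inl x, Inl x') \<in> catalan_sum_mon A B \<longleftrightarrow> (x, x') \<in> mon_rel A"
  "(Inr y, Inr y') \<in> catalan_sum_mon A B \<longleftrightarrow> (y, y') \<in> mon_rel B"
  "(Inl x, Inr y) \<in> catalan_sum_mon A B \<longleftrightarrow> x = rbot A \<and> y \<in> carrier B"
  "(Inr y, Inl x) \<in> catalan_sum_mon A B \<longleftrightarrow> y \<in> carrier B \<and> x \<in> carrier A \<and> x \<noteq> rbot A"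
  by (auto simp: catalan_sum_mon_def image_iff Bex_def Ball_def)

lemma ball_Plus: "(\<forall>z\<in>S <+> T. P z) \<longleftrightarrow> (\<forall>x\<in>S. P (Inl x)) \<and> (\<forall>y\<in>T. P (Inr y))"
  by auto

text \<open>Inside a summand, meets, joins and residuals are those of the summand, except that
  residuals of the bottom of \<open>A\<close> become the top of the sum. Mixed pairs depend on
  whether the entry from \<open>A\<close> is the bottom and whether the entry from \<open>B\<close>
  lies above the identity of \<open>B\<close>.\<close>

lemma residuated_frame_catalan_sum:
  assumes "finite_conservative_crl A" "finite_conservative_crl B"
  shows "residuated_frame (carrier A <+> carrier B) (catalan_sum_le A B) (catalan_sum_mon A B)"
proof -
  interpret A: finite_conservative_crl A by fact
  interpret B: finite_conservative_crl B by fact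
  let ?S = "carrier A <+> carrier B" and ?l = "catalan_sum_le A B" and ?m = "catalan_sum_mon A B"
  note simps = catalan_sum_le_simps catalan_sum_mon_simps
  have pol: "partial_order (ord_of ?S ?l)"
  proof (rule partial_order_ord_ofI)
    fix x y z assume "x \<in> ?S" "y \<in> ?S" "z \<in> ?S" "(x, y) \<in> ?l" "(y, z) \<in> ?l"
    then show "(x, z) \<in> ?l"
      by (auto simp: simps A.le_rbot_iff A.rbot_le dest: A.le_trans B.le_trans A.le_carrier)
  qed (auto simp: simps A.le_refl B.le_refl dest: A.le_antisym B.le_antisym)
  have lat: "lattice (ord_of ?S ?l)"
  proof (rule lattice_ord_ofI[OF pol])
    fix x y assume xy: "x \<in> ?S" "y \<in> ?S"
    let ?lb = "\<lambda>x y w. (w, x) \<in> ?l \<and> (w, y) \<in> ?l \<and> (\<forall>z\<in>?S. (z, x) \<in> ?l \<longrightarrow> (z, y) \<in> ?l \<longrightarrow> (z, w) \<in> ?l)"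
    \<comment> \<open>No \<open>Inr\<close> lies below an \<open>Inl\<close>, so the lower bounds
      come from \<open>A\<close>. If \<open>b\<close> is above the identity, then
      \<open>Inl a\<close> is already below \<open>Inr b\<close>; otherwise the bottom is the only
      element of \<open>A\<close> below \<open>Inr b\<close>.\<close>
    have mixed: "\<exists>w\<in>?S. ?lb (Inl a) (Inr b) w" if ab: "a \<in> carrier A" "b \<in> carrier B" for a b
    proof (cases "(\<one>\<^bsub>B\<^esub>, b) \<in> lat_rel B")
      case True
      then have "?lb (Inl a) (Inr b) (Inl a)"
        using ab by (simp add: ball_Plus simps A.le_refl)
      then show ?thesis using ab by blast
    next
      case False
      then have "?lb (Inl a) (Inr b) (Inl (rbot A))"
        using ab by (simp add: ball_Plus simps A.rbot_le A.rbot_closed A.le_refl)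
      then show ?thesis using A.rbot_closed by blast
    qed
    have left: "?lb (Inl a) (Inl a') (Inl (rmeet A a a'))" if "a \<in> carrier A" "a' \<in> carrier A" for a a'
      using that by (simp add: ball_Plus simps A.rmeet_le A.rmeet_greatest)
    have right: "?lb (Inr b) (Inr b') (Inr (rmeet B b b'))" if "b \<in> carrier B" "b' \<in> carrier B" for b b'
      using that by (auto simp add: ball_Plus simps B.rmeet_le B.rmeet_greatest B.rmeet_closed)
    show "\<exists>w\<in>?S. ?lb x y w"
    proof (cases x; cases y)
      fix a b assume "x = Inl a" "y = Inr b"
      then show ?thesis using mixed xy by blast
    next
      fix a b assume "x = Inr b" "y = Inl a"
      moreover have "\<exists>w\<in>?S. ?lb (Inl a) (Inr b) w" using mixed xy calculation by blast
      ultimately show ?thesis by blast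
    next
      fix a a' assume eq: "x = Inl a" "y = Inl a'"
      then show ?thesis using left[of a a'] xy A.rmeet_closed by blast
    next
      fix b b' assume eq: "x = Inr b" "y = Inr b'"
      then show ?thesis using right[of b b'] xy B.rmeet_closed by blast
    qed
  next
    fix x y assume xy: "x \<in> ?S" "y \<in> ?S"
    let ?ub = "\<lambda>x y w. (x, w) \<in> ?l \<and> (y, w) \<in> ?l \<and> (\<forall>z\<in>?S. (x, z) \<in> ?l \<longrightarrow> (y, z) \<in> ?l \<longrightarrow> (w, z) \<in> ?l)"
    \<comment> \<open>The bottom is below \<open>Inr b\<close>. For any other \<open>a\<close>, the
      upper bounds of \<open>Inl a\<close> in \<open>B\<close> are the elements above the identity,
      so the join with \<open>b\<close> is taken after adding the identity.\<close>
    have mixed: "\<exists>w\<in>?S. ?ub (Inl a) (Inr b) w" if ab: "a \<in> carrier A" "b \<in> carrier B" for a b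
    proof (cases "a = rbot A")
      case True
      then have "?ub (Inl a) (Inr b) (Inr b)"
        using ab by (simp add: ball_Plus simps B.le_refl)
      then show ?thesis using ab by blast
    next
      case False
      then have "?ub (Inl a) (Inr b) (Inr (rjoin B \<one>\<^bsub>B\<^esub> b))"
        using ab by (simp add: ball_Plus simps B.rjoin_ge B.rjoin_least B.rjoin_closed)
      then show ?thesis using ab B.rjoin_closed by blast
    qed
    \<comment> \<open>An element of \<open>B\<close> not above the identity bounds both
      \<open>Inl a\<close> and \<open>Inl a'\<close> only if both are the bottom, and then their
      join is the bottom too.\<close>
    have left: "?ub (Inl a) (Inl a') (Inl (rjoin A a a'))" if "a \<in> carrier A" "a' \<in> carrier A" for a a'
      using that A.rjoin_closed[OF that] A.le_iff_rjoin[of "rbot A" "rbot A"]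
        A.le_refl[OF A.rbot_closed] A.rbot_closed
      by (auto simp: ball_Plus simps A.rjoin_ge A.rjoin_least)
    have right: "?ub (Inr b) (Inr b') (Inr (rjoin B b b'))" if "b \<in> carrier B" "b' \<in> carrier B" for b b'
      using that by (simp add: ball_Plus simps B.rjoin_ge B.rjoin_least)
    show "\<exists>w\<in>?S. ?ub x y w"
    proof (cases x; cases y)
      fix a b assume "x = Inl a" "y = Inr b"
      then show ?thesis using mixed xy by blast
    next
      fix a b assume "x = Inr b" "y = Inl a"
      moreover have "\<exists>w\<in>?S. ?ub (Inl a) (Inr b) w" using mixed xy calculation by blast
      ultimately show ?thesis by blast
    next
      fix a a' assume eq: "x = Inl a" "y = Inl a'"
      then show ?thesis using left[of a a'] xy A.rjoin_closed by blast
    next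
      fix b b' assume eq: "x = Inr b" "y = Inr b'"
      then show ?thesis using right[of b b'] xy B.rjoin_closed by blast
    qed
  qed
  have pom: "partial_order (ord_of ?S ?m)"
  proof (rule partial_order_ord_ofI)
    fix x y z assume "x \<in> ?S" "y \<in> ?S" "z \<in> ?S" "(x, y) \<in> ?m" "(y, z) \<in> ?m"
    then show "(x, z) \<in> ?m"
      by (auto simp: simps A.mon_rbot A.mon_rbot_iff dest: A.mon_trans B.mon_trans)
  qed (auto simp: simps A.mon_refl B.mon_refl dest: A.mon_antisym B.mon_antisym)
  have tom: "total_order (ord_of ?S ?m)"
  proof (rule total_order_ord_ofI[OF pom])
    fix x y assume "x \<in> ?S" "y \<in> ?S"
    then show "(x, y) \<in> ?m \<or> (y, x) \<in> ?m"
      using A.mon_total[of "projl x" "projl y"] B.mon_total[of "projr x" "projr y"]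
      by (auto simp: simps)
  qed
  interpret L: lattice "ord_of ?S ?l" by (rule lat)
  interpret M: total_order "ord_of ?S ?m" by (rule tom)
  show ?thesis
  proof
    fix x y assume xy: "x \<in> ?S" "y \<in> ?S"
    let ?res = "\<lambda>w. \<forall>z\<in>?S. (if (x, z) \<in> ?m then x else z, y) \<in> ?l \<longleftrightarrow> (z, w) \<in> ?l"
    \<comment> \<open>The greatest element of \<open>B\<close>:
      \<open>\<bottom>b = \<bottom>\<close> for all \<open>b\<close>, so every \<open>b\<close> is
      below \<open>\<bottom> \<rightarrow> \<bottom>\<close>.\<close>
    let ?t = "rimp B (rbot B) (rbot B)"
    have t: "?t \<in> carrier B" by (simp add: B.rbot_closed B.rimp_closed)
    have t_top: "(b, ?t) \<in> lat_rel B" if "b \<in> carrier B" for b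
      using B.residuation[OF B.rbot_closed that B.rbot_closed] B.mon_rbot[OF that]
        B.le_refl[OF B.rbot_closed] by (simp add: mon_rel_def)
    have "\<exists>w\<in>?S. ?res w"
    proof (cases x; cases y)
      fix a a' assume eq: "x = Inl a" "y = Inl a'"
      with xy have a: "a \<in> carrier A" "a' \<in> carrier A" by auto
      show ?thesis
      proof (cases "a = rbot A")
        case True
        \<comment> \<open>The bottom absorbs everything and is below everything, so its residual is
          the top of the sum. That is the top of \<open>B\<close>, since it lies above the identity
          of \<open>B\<close> and hence above every \<open>Inl\<close>.\<close>
        then have "?res (Inr ?t)"
          unfolding eq using a t t_top by (simp add: ball_Plus simps A.mon_rbot A.rbot_le)
        then show ?thesis using t by blast
      next
        case False
        \<comment> \<open>For \<open>z\<close> from \<open>B\<close> both sides are false: the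
          product is \<open>z\<close> itself, and no \<open>Inr\<close> is below an
          \<open>Inl\<close>.\<close>
        then have "?res (Inl (rimp A a a'))"
          unfolding eq using a by (simp add: ball_Plus simps A.mult_eq_if flip: A.residuation)
        then show ?thesis using a A.rimp_closed by blast
      qed
    next
      fix a b assume eq: "x = Inl a" "y = Inr b"
      with xy have ab: "a \<in> carrier A" "b \<in> carrier B" by auto
      show ?thesis
      proof (cases "a = rbot A")
        case True
        then have "?res (Inr ?t)"
          unfolding eq using ab t t_top by (simp add: ball_Plus simps A.mon_rbot)
        then show ?thesis using t by blast
      next
        case False
        \<comment> \<open>Elements of \<open>B\<close> are fixed by \<open>Inl a\<close>. For
          \<open>z\<close> from \<open>A\<close> it matters only whether the product is the bottom,
          and by conservativity with \<open>a\<close> nonbottom this happens exactly when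
          \<open>z\<close> is.\<close>
        then have "?res (Inr b)"
          unfolding eq using ab A.mon_antisym[OF _ A.mon_rbot[of a]] by (auto simp add: ball_Plus simps)
        then show ?thesis using ab by blast
      qed
    next
      fix a b assume eq: "x = Inr b" "y = Inl a"
      with xy have ab: "a \<in> carrier A" "b \<in> carrier B" by auto
      \<comment> \<open>Multiplying \<open>Inr b\<close> by anything but the bottom stays in
        \<open>B\<close>, hence is never below \<open>Inl a\<close>.\<close>
      then have "?res (Inl (rbot A))"
        unfolding eq by (simp add: ball_Plus simps A.le_rbot_iff A.rbot_le)
      then show ?thesis using A.rbot_closed by blast
    next
      fix b b' assume eq: "x = Inr b" "y = Inr b'"
      with xy have b: "b \<in> carrier B" "b' \<in> carrier B" by auto
      \<comment> \<open>For a nonbottom \<open>z\<close> from \<open>A\<close> the product is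
        \<open>Inr b\<close>. By residuation \<open>b \<le> b'\<close> says that the identity is
        below \<open>b \<rightarrow> b'\<close>, which is the condition for \<open>z\<close> to lie
        below \<open>Inr (rimp B b b')\<close>.\<close>
      then have "?res (Inr (rimp B b b'))"
        unfolding eq by (simp add: ball_Plus simps B.rimp_closed B.mult_eq_if B.mon_one flip: B.residuation)
      then show ?thesis using b B.rimp_closed by blast
    qed
    then show "\<exists>w\<in>?S. \<forall>z\<in>?S. (x \<sqinter>\<^bsub>ord_of ?S ?m\<^esub> z, y) \<in> ?l \<longleftrightarrow> (z, w) \<in> ?l"
      using total_order_meet_eq[OF tom] xy by simp
  next
    show "finite ?S" "?S \<noteq> {}" using A.finite_carrier B.finite_carrier A.one_closed by auto
    show "?l \<subseteq> ?S \<times> ?S" "?m \<subseteq> ?S \<times> ?S"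
      using A.rbot_closed by (auto simp: catalan_sum_le_def catalan_sum_mon_def lat_rel_def mon_rel_def)
  qed
qed

section \<open>Restrictions to subsets and their reassembly\<close>

definition restriction :: "'a rlat \<Rightarrow> 'a set \<Rightarrow> 'a rlat" where
  "restriction A T = rlat_of T (lat_rel A \<inter> T \<times> T) (mon_rel A \<inter> T \<times> T)"

context finite_conservative_crl
begin

text \<open>Multiplication by \<open>z\<close> is left adjoint to \<open>rimp A z\<close>; hence it
  is monotone and, as used in \<open>mult_rjoin_le\<close>, compatible with joins.\<close>

lemma mult_le_mult: "\<lbrakk>(x, y) \<in> lat_rel A; z \<in> carrier A\<rbrakk> \<Longrightarrow> (z \<otimes> x, z \<otimes> y) \<in> lat_rel A"
  by (meson le_carrier le_refl le_trans m_closed residuation rimp_closed)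

lemma mult_rjoin_le:
  assumes "x \<in> carrier A" "y \<in> carrier A" "z \<in> carrier A"
    and "(z \<otimes> x, w) \<in> lat_rel A" "(z \<otimes> y, w) \<in> lat_rel A"
  shows "(z \<otimes> rjoin A x y, w) \<in> lat_rel A"
proof -
  have "w \<in> carrier A" using assms(4) le_carrier by blast
  then show ?thesis
    using assms by (simp add: residuation rjoin_closed rjoin_least)
qed

text \<open>Closure under products is automatic by conservativity. Residuals are only asked to exist
  relative to \<open>T\<close>, because \<open>rimp A\<close> may leave \<open>T\<close>: in a
  proper ideal, the residual of the bottom must be recomputed.\<close>

lemma residuated_frame_restriction:
  assumes T: "T \<subseteq> carrier A" "T \<noteq> {}"
    and meet: "\<And>x y. \<lbrakk>x \<in> T; y \<in> T\<rbrakk> \<Longrightarrow> rmeet A x y \<in> T"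
    and join: "\<And>x y. \<lbrakk>x \<in> T; y \<in> T\<rbrakk> \<Longrightarrow> rjoin A x y \<in> T"
    and res: "\<And>x y. \<lbrakk>x \<in> T; y \<in> T\<rbrakk> \<Longrightarrow>
      \<exists>w\<in>T. \<forall>z\<in>T. (x \<otimes> z, y) \<in> lat_rel A \<longleftrightarrow> (z, w) \<in> lat_rel A"
  shows "residuated_frame T (lat_rel A \<inter> T \<times> T) (mon_rel A \<inter> T \<times> T)"
proof -
  let ?l = "lat_rel A \<inter> T \<times> T" and ?m = "mon_rel A \<inter> T \<times> T"
  have sub: "x \<in> carrier A" if "x \<in> T" for x using T that by blast
  have pol: "partial_order (ord_of T ?l)"
    by (rule partial_order_ord_ofI) (auto intro: le_refl sub le_antisym le_trans)
  have pom: "partial_order (ord_of T ?m)"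
    by (rule partial_order_ord_ofI) (auto intro: mon_refl sub mon_antisym mon_trans)
  interpret L: lattice "ord_of T ?l"
  proof (rule lattice_ord_ofI[OF pol])
    fix x y assume "x \<in> T" "y \<in> T"
    then show "\<exists>w\<in>T. (w, x) \<in> ?l \<and> (w, y) \<in> ?l \<and> (\<forall>z\<in>T. (z, x) \<in> ?l \<longrightarrow> (z, y) \<in> ?l \<longrightarrow> (z, w) \<in> ?l)"
      by (intro bexI[of _ "rmeet A x y"]) (auto simp: meet sub rmeet_le rmeet_greatest)
    show "\<exists>w\<in>T. (x, w) \<in> ?l \<and> (y, w) \<in> ?l \<and> (\<forall>z\<in>T. (x, z) \<in> ?l \<longrightarrow> (y, z) \<in> ?l \<longrightarrow> (w, z) \<in> ?l)"
      using \<open>x \<in> T\<close> \<open>y \<in> T\<close>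
      by (intro bexI[of _ "rjoin A x y"]) (auto simp: join sub rjoin_ge rjoin_least)
  qed
  have tom: "total_order (ord_of T ?m)"
    by (rule total_order_ord_ofI[OF pom]) (use mon_total sub in auto)
  interpret M: total_order "ord_of T ?m" by (rule tom)
  show ?thesis
  proof
    fix x y assume xy: "x \<in> T" "y \<in> T"
    have mult: "x \<sqinter>\<^bsub>ord_of T ?m\<^esub> z = x \<otimes> z" if "z \<in> T" for z
      using total_order_meet_eq[OF tom xy(1) that] mult_eq_if[of x z] xy that sub by simp
    have "x \<otimes> z \<in> T" if "z \<in> T" for z
      using mult_cases[of x z] xy that sub by auto
    then show "\<exists>w\<in>T. \<forall>z\<in>T. (x \<sqinter>\<^bsub>ord_of T ?m\<^esub> z, y) \<in> ?l \<longleftrightarrow> (z, w) \<in> ?l"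
      using res[OF xy] xy by (auto simp: mult)
  next
    show "finite T" using T finite_carrier finite_subset by blast
  qed (use T in auto)
qed

end

text \<open>The hypotheses are the clauses of \<open>catalan_sum_le\<close> and
  \<open>catalan_sum_mon\<close> read inside \<open>A\<close>, with \<open>u\<close> in the role of
  the identity of the second summand.\<close>

lemma rlat_iso_catalan_sum_restriction:
  assumes "finite_conservative_crl A"
    and T: "residuated_frame T (lat_rel A \<inter> T \<times> T) (mon_rel A \<inter> T \<times> T)"
    and U: "residuated_frame U (lat_rel A \<inter> U \<times> U) (mon_rel A \<inter> U \<times> U)"
    and part: "T \<union> U = carrier A" "T \<inter> U = {}" and bot: "rbot A \<in> T"
    and u: "u \<in> U" "\<And>y. y \<in> U \<Longrightarrow> (y, u) \<in> mon_rel A"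
    and le: "\<And>x y. \<lbrakk>x \<in> T; y \<in> U\<rbrakk> \<Longrightarrow> (x, y) \<in> lat_rel A \<longleftrightarrow> x = rbot A \<or> (u, y) \<in> lat_rel A"
    and not_le: "\<And>x y. \<lbrakk>x \<in> T; y \<in> U\<rbrakk> \<Longrightarrow> (y, x) \<notin> lat_rel A"
    and mon: "\<And>x y. \<lbrakk>x \<in> T; y \<in> U; x \<noteq> rbot A\<rbrakk> \<Longrightarrow> (y, x) \<in> mon_rel A"
  shows "rlat_iso (catalan_sum (restriction A T) (restriction A U)) A"
proof -
  interpret A: finite_conservative_crl A by fact
  interpret T: residuated_frame T "lat_rel A \<inter> T \<times> T" "mon_rel A \<inter> T \<times> T" by (rule T)
  interpret U: residuated_frame U "lat_rel A \<inter> U \<times> U" "mon_rel A \<inter> U \<times> U" by (rule U)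
  let ?T = "restriction A T" and ?U = "restriction A U"
  have rels: "carrier ?T = T" "lat_rel ?T = lat_rel A \<inter> T \<times> T" "mon_rel ?T = mon_rel A \<inter> T \<times> T"
    "carrier ?U = U" "lat_rel ?U = lat_rel A \<inter> U \<times> U" "mon_rel ?U = mon_rel A \<inter> U \<times> U"
    unfolding restriction_def
    by (simp_all only: T.carrier_rlat_of T.lat_rel_rlat_of T.mon_rel_rlat_of
        U.carrier_rlat_of U.lat_rel_rlat_of U.mon_rel_rlat_of)
  interpret RT: finite_conservative_crl ?T
    unfolding restriction_def by (rule T.finite_conservative_crl_rlat_of)
  interpret RU: finite_conservative_crl ?U
    unfolding restriction_def by (rule U.finite_conservative_crl_rlat_of)
  interpret S: residuated_frame "carrier ?T <+> carrier ?U" "catalan_sum_le ?T ?U" "catalan_sum_mon ?T ?U"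
    by (rule residuated_frame_catalan_sum) unfold_locales
  have TA: "x \<in> carrier A" if "x \<in> T" for x using part that by blast
  have UA: "x \<in> carrier A" if "x \<in> U" for x using part that by blast
  have rbot: "rbot ?T = rbot A"
    by (rule RT.rbot_eqI) (simp_all add: rels bot A.rbot_le TA)
  have one: "\<one>\<^bsub>?U\<^esub> = u"
    by (rule RU.one_eqI) (simp_all add: rels u)
  \<comment> \<open>The pairs absent from the monoidal order of the sum must be absent in
    \<open>A\<close> as well; antisymmetry and disjointness of \<open>T\<close> and \<open>U\<close>
    exclude them.\<close>
  have not_mon: "(x, y) \<notin> mon_rel A" if "x \<in> T" "y \<in> U" "x \<noteq> rbot A" for x y
    using mon[OF that] A.mon_antisym[of x y] part that by blast
  have not_mon_bot: "(y, rbot A) \<notin> mon_rel A" if "y \<in> U" for y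
    using A.mon_rbot[OF UA[OF that]] A.mon_antisym[of y "rbot A"] part bot that by blast
  show ?thesis
  \<comment> \<open>The isomorphism forgets the tags; it is bijective because \<open>T\<close> and
    \<open>U\<close> partition the carrier.\<close>
  proof (rule rlat_isoI[of _ _ "case_sum id id"])
    show "finite_conservative_crl (catalan_sum ?T ?U)"
      unfolding catalan_sum_eq by (rule S.finite_conservative_crl_rlat_of)
    have carr: "carrier (catalan_sum ?T ?U) = T <+> U"
      unfolding catalan_sum_eq S.carrier_rlat_of by (simp add: rels)
    show "bij_betw (case_sum id id) (carrier (catalan_sum ?T ?U)) (carrier A)"
      unfolding carr using part by (auto simp: bij_betw_def inj_on_def Plus_def image_Un image_image)
    fix x y assume "x \<in> carrier (catalan_sum ?T ?U)" "y \<in> carrier (catalan_sum ?T ?U)"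
    then have xy: "x \<in> T <+> U" "y \<in> T <+> U" by (simp_all add: carr)
    show "(case_sum id id x, case_sum id id y) \<in> lat_rel A \<longleftrightarrow> (x, y) \<in> lat_rel (catalan_sum ?T ?U)"
      unfolding catalan_sum_eq S.lat_rel_rlat_of using xy u(1)
      by (auto simp: catalan_sum_le_simps rels rbot one le not_le)
    show "(case_sum id id x, case_sum id id y) \<in> mon_rel A \<longleftrightarrow> (x, y) \<in> mon_rel (catalan_sum ?T ?U)"
      unfolding catalan_sum_eq S.mon_rel_rlat_of using xy
      by (auto simp: catalan_sum_mon_simps rels rbot mon not_mon_bot A.mon_rbot UA dest: not_mon)
  qed fact
qed

section \<open>Decomposition of a nontrivial algebra\<close>

lemma (in finite_conservative_crl) catalan_decomposition:
  assumes "carrier A \<noteq> {rbot A}"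
  obtains T U where "T \<subset> carrier A" "U \<subset> carrier A"
    "finite_conservative_crl (restriction A T)" "finite_conservative_crl (restriction A U)"
    "carrier (restriction A T) = T" "carrier (restriction A U) = U"
    "rlat_iso (catalan_sum (restriction A T) (restriction A U)) A"
proof -
  \<comment> \<open>The converse relation turns a greatest element into a least one:
    \<open>c\<close> is the \<open>\<sqsubseteq>\<close>-least nonbottom element.\<close>
  have "\<exists>c\<in>carrier A - {rbot A}. \<forall>x\<in>carrier A - {rbot A}. (x, c) \<in> (mon_rel A)\<inverse>"
  proof (rule finite_directed_has_greatest)
    fix x y assume "x \<in> carrier A - {rbot A}" "y \<in> carrier A - {rbot A}"
    then show "\<exists>z\<in>carrier A - {rbot A}. (x, z) \<in> (mon_rel A)\<inverse> \<and> (y, z) \<in> (mon_rel A)\<inverse>"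
      using mon_total[of x y] mon_refl[of x] mon_refl[of y] by auto
  next
    fix x y z assume "(x, y) \<in> (mon_rel A)\<inverse>" "(y, z) \<in> (mon_rel A)\<inverse>"
    then show "(x, z) \<in> (mon_rel A)\<inverse>" using mon_trans[of z y x] by simp
  qed (use finite_carrier assms rbot_closed in auto)
  then obtain c where c: "c \<in> carrier A" "c \<noteq> rbot A"
    and c_least: "\<And>x. \<lbrakk>x \<in> carrier A; x \<noteq> rbot A\<rbrakk> \<Longrightarrow> (c, x) \<in> mon_rel A" by auto
  have c_mult: "x \<otimes> c = c" if "x \<in> carrier A" "x \<noteq> rbot A" for x
    using c_least[OF that] m_comm[OF that(1) c(1)] by (simp add: mon_rel_def)
  define U where "U = {x \<in> carrier A. (c, x) \<in> lat_rel A}"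
  define T where "T = carrier A - U"
  have part: "T \<union> U = carrier A" "T \<inter> U = {}" by (auto simp: T_def U_def)
  have cU: "c \<in> U" using c by (simp add: U_def le_refl)
  have bot: "rbot A \<in> T" using c by (simp add: T_def U_def rbot_closed le_rbot_iff)
  have TA: "x \<in> carrier A" if "x \<in> T" for x using part that by blast
  have UA: "x \<in> carrier A" if "x \<in> U" for x using part that by blast
  have U_up: "y \<in> U" if "x \<in> U" "(x, y) \<in> lat_rel A" for x y
    using that le_trans[of c x y] le_carrier by (auto simp: U_def)
  have U_nonbot: "y \<noteq> rbot A" if "y \<in> U" for y using that bot part by blast
  \<comment> \<open>Multiplying \<open>c \<le> y\<close> by a nonbottom \<open>x\<close> gives
    \<open>c = xc \<le> xy\<close>.\<close>
  have U_mult: "x \<otimes> y \<in> U" if "x \<in> carrier A" "x \<noteq> rbot A" "y \<in> U" for x y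
    using mult_le_mult[of c y x] c_mult that by (simp add: U_def)
  have not_le: "(y, x) \<notin> lat_rel A" if "x \<in> T" "y \<in> U" for x y
    using U_up[OF that(2)] that part by blast
  have mon: "(y, x) \<in> mon_rel A" if "x \<in> T" "y \<in> U" "x \<noteq> rbot A" for x y
  proof -
    have "x \<otimes> y \<in> U" by (rule U_mult[OF TA[OF that(1)] that(3,2)])
    then have "x \<otimes> y \<noteq> x" using that(1) part(2) by auto
    then have "x \<otimes> y = y" using mult_cases[OF TA[OF that(1)] UA[OF that(2)]] by simp
    then show ?thesis using that TA UA m_comm[of x y] by (simp add: mon_rel_def)
  qed
  \<comment> \<open>Join primality of \<open>c\<close>, with \<open>x\<close> the
    \<open>\<sqsubseteq>\<close>-smaller element. Since \<open>xx = xy = x\<close>, the product of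
    \<open>x\<close> with the join is below \<open>x\<close>, so it is not in \<open>U\<close>; by
    \<open>U_mult\<close> neither is the join.\<close>
  have T_join_aux: "rjoin A x y \<in> T" if "x \<in> T" "y \<in> T" "(x, y) \<in> mon_rel A" for x y
  proof (cases "x = rbot A")
    case True
    then show ?thesis using that TA[of y] rbot_le le_iff_rjoin rbot_closed by simp
  next
    case False
    have xy: "x \<in> carrier A" "y \<in> carrier A" "x \<otimes> y = x" "x \<otimes> x = x"
      using that TA mon_refl[of x] by (auto simp: mon_rel_def)
    then have "(x \<otimes> rjoin A x y, x) \<in> lat_rel A"
      using mult_rjoin_le[of x y x x] le_refl by simp
    then have "x \<otimes> rjoin A x y \<notin> U" using not_le[OF that(1)] by blast
    then have "rjoin A x y \<notin> U" using U_mult[OF xy(1) False] by blast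
    then show ?thesis using xy rjoin_closed by (simp add: T_def)
  qed
  have T_join: "rjoin A x y \<in> T" if "x \<in> T" "y \<in> T" for x y
    using T_join_aux[of x y] T_join_aux[of y x] that mon_total[of x y] rjoin_comm[of x y] TA by auto
  have "\<exists>u\<in>U. \<forall>x\<in>U. (x, u) \<in> mon_rel A"
  proof (rule finite_directed_has_greatest)
    fix x y assume "x \<in> U" "y \<in> U"
    then show "\<exists>z\<in>U. (x, z) \<in> mon_rel A \<and> (y, z) \<in> mon_rel A"
      using mon_total[of x y] mon_refl[of x] mon_refl[of y] UA by auto
  next
    show "finite U" using finite_carrier by (simp add: U_def)
  qed (use cU in \<open>auto elim: mon_trans\<close>)
  then obtain u where u: "u \<in> U" "\<And>y. y \<in> U \<Longrightarrow> (y, u) \<in> mon_rel A" by auto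
  have u_mult: "u \<otimes> y = y" if "y \<in> U" for y
    using u(2)[OF that] UA[OF u(1)] UA[OF that] m_comm[of u y] by (simp add: mon_rel_def)
  have le_u: "(x, u) \<in> lat_rel A" if "x \<in> T" for x
  proof (cases "x = rbot A")
    case False
    have xu: "x \<in> carrier A" "u \<in> carrier A" using TA UA that u by auto
    have "u \<otimes> x = u" using mon[OF that u(1) False] by (simp add: mon_rel_def)
    then have "(u \<otimes> rjoin A x u, u) \<in> lat_rel A"
      using xu u_mult[OF u(1)] mult_rjoin_le[of x u u u] le_refl by simp
    moreover have "rjoin A x u \<in> U" using U_up[OF u(1)] rjoin_ge xu by blast
    ultimately have "(rjoin A x u, u) \<in> lat_rel A" using u_mult by simp
    then show ?thesis by (rule le_trans[OF rjoin_ge(1)[OF xu]])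
  qed (use rbot_le UA u in blast)
  have le: "(x, y) \<in> lat_rel A \<longleftrightarrow> x = rbot A \<or> (u, y) \<in> lat_rel A" if "x \<in> T" "y \<in> U" for x y
  proof
    assume "(x, y) \<in> lat_rel A"
    then have "(u \<otimes> x, y) \<in> lat_rel A"
      using mult_le_mult[of x y u] u_mult[OF that(2)] UA[OF u(1)] by simp
    then show "x = rbot A \<or> (u, y) \<in> lat_rel A"
      using mon[OF that(1) u(1)] by (cases "x = rbot A") (simp_all add: mon_rel_def)
  next
    assume "x = rbot A \<or> (u, y) \<in> lat_rel A"
    then show "(x, y) \<in> lat_rel A"
      using rbot_le[OF UA[OF that(2)]] le_trans[OF le_u[OF that(1)], of y] by auto
  qed
  \<comment> \<open>Closure of \<open>T\<close> under joins yields a greatest element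
    \<open>t\<close>, which will be the residual of the bottom inside \<open>T\<close>.\<close>
  have "\<exists>t\<in>T. \<forall>x\<in>T. (x, t) \<in> lat_rel A"
  proof (rule finite_directed_has_greatest)
    fix x y assume "x \<in> T" "y \<in> T"
    then show "\<exists>z\<in>T. (x, z) \<in> lat_rel A \<and> (y, z) \<in> lat_rel A"
      by (intro bexI[of _ "rjoin A x y"]) (simp_all add: T_join rjoin_ge TA)
  next
    show "finite T" using finite_carrier by (simp add: T_def)
  qed (use bot in \<open>auto elim: le_trans\<close>)
  then obtain t where t: "t \<in> T" "\<And>x. x \<in> T \<Longrightarrow> (x, t) \<in> lat_rel A" by blast
  have frame_T: "residuated_frame T (lat_rel A \<inter> T \<times> T) (mon_rel A \<inter> T \<times> T)"
  proof (rule residuated_frame_restriction)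
    fix x y assume xy: "x \<in> T" "y \<in> T"
    then have xyA: "x \<in> carrier A" "y \<in> carrier A" using TA by auto
    have "rmeet A x y \<notin> U" using not_le[OF xy(1)] rmeet_le(1)[OF xyA] by blast
    then show "rmeet A x y \<in> T" using xyA rmeet_closed by (simp add: T_def)
    show "\<exists>w\<in>T. \<forall>z\<in>T. (x \<otimes> z, y) \<in> lat_rel A \<longleftrightarrow> (z, w) \<in> lat_rel A"
    proof (cases "x = rbot A")
      case True
      then have "(x \<otimes> z, y) \<in> lat_rel A" if "z \<in> T" for z
        using mon_rbot[OF TA[OF that]] rbot_le[OF xyA(2)] by (simp add: mon_rel_def)
      then show ?thesis using t by blast
    next
      case False
      have imp: "rimp A x y \<in> carrier A" using xyA rimp_closed by blast
      then have "(x \<otimes> rimp A x y, y) \<in> lat_rel A" using xyA by (simp add: residuation le_refl)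
      \<comment> \<open>Otherwise \<open>U_mult\<close> would put the product of \<open>x\<close>
        with \<open>rimp A x y\<close> into \<open>U\<close>, although it is below \<open>y\<close>,
        an element of \<open>T\<close>.\<close>
      then have "rimp A x y \<notin> U" using U_mult[OF xyA(1) False] not_le[OF xy(2)] by blast
      then have "rimp A x y \<in> T" using imp by (simp add: T_def)
      then show ?thesis using xyA TA by (intro bexI[of _ "rimp A x y"]) (simp_all add: residuation)
    qed
  qed (use bot T_join in \<open>auto simp: T_def\<close>)
  have frame_U: "residuated_frame U (lat_rel A \<inter> U \<times> U) (mon_rel A \<inter> U \<times> U)"
  proof (rule residuated_frame_restriction)
    fix x y assume xy: "x \<in> U" "y \<in> U"
    then have xyA: "x \<in> carrier A" "y \<in> carrier A" using UA by auto
    show "rmeet A x y \<in> U" "rjoin A x y \<in> U"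
      using xy rmeet_greatest[of c x y] rmeet_closed[of x y] U_up[of x "rjoin A x y"] rjoin_ge[of x y]
      by (auto simp: U_def)
    \<comment> \<open>Since \<open>xc = c \<le> y\<close>, residuation places \<open>c\<close> below
      \<open>rimp A x y\<close>, so the residual of \<open>A\<close> stays in
      \<open>U\<close>.\<close>
    have "(x \<otimes> c, y) \<in> lat_rel A" using c_mult xyA U_nonbot xy by (simp add: U_def)
    then have "rimp A x y \<in> U" using residuation[OF xyA(1) c(1) xyA(2)] le_carrier by (auto simp: U_def)
    then show "\<exists>w\<in>U. \<forall>z\<in>U. (x \<otimes> z, y) \<in> lat_rel A \<longleftrightarrow> (z, w) \<in> lat_rel A"
      using xyA UA by (intro bexI[of _ "rimp A x y"]) (simp_all add: residuation)
  qed (use cU in \<open>auto simp: U_def\<close>)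
  interpret FT: residuated_frame T "lat_rel A \<inter> T \<times> T" "mon_rel A \<inter> T \<times> T" by (rule frame_T)
  interpret FU: residuated_frame U "lat_rel A \<inter> U \<times> U" "mon_rel A \<inter> U \<times> U" by (rule frame_U)
  show ?thesis
  proof (rule that[of T U])
    \<comment> \<open>Both inclusions are strict because \<open>c\<close> is outside
      \<open>T\<close> and the bottom is outside \<open>U\<close>; the induction on the cardinality
      relies on this.\<close>
    show "T \<subset> carrier A" "U \<subset> carrier A" using part bot cU by auto
    show "rlat_iso (catalan_sum (restriction A T) (restriction A U)) A"
      by (rule rlat_iso_catalan_sum_restriction[OF finite_conservative_crl_axioms frame_T frame_U
            part bot u le not_le mon])
  qed (simp_all add: restriction_def FT.carrier_rlat_of FU.carrier_rlat_of
      FT.finite_conservative_crl_rlat_of FU.finite_conservative_crl_rlat_of)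
qed

section \<open>The two inclusions and the transfer to natural numbers\<close>

lemma finite_conservative_crl_catalan_sum:
  assumes "finite_conservative_crl A" "finite_conservative_crl B"
  shows "finite_conservative_crl (catalan_sum A B)"
  unfolding catalan_sum_eq
  by (rule residuated_frame.finite_conservative_crl_rlat_of[OF residuated_frame_catalan_sum[OF assms]])

lemma finite_conservative_crl_one_element:
  assumes "one_element_algebra A"
  shows "finite_conservative_crl A"
proof -
  obtain a where a: "carrier A = {a}" "\<one>\<^bsub>A\<^esub> = a" "a \<otimes>\<^bsub>A\<^esub> a = a"
    "rmeet A a a = a" "rjoin A a a = a" "rimp A a a = a"
    using assms by (auto simp: one_element_algebra_def)
  show ?thesis
    by unfold_locales (simp_all add: a lat_rel_def conservative_def)
qed

lemma catalan_nat_imp_finite_conservative_crl: "catalan_nat A \<Longrightarrow> finite_conservative_crl A"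
  by (induction rule: catalan_nat.induct)
    (blast intro: finite_conservative_crl_one_element finite_conservative_crl_catalan_sum
      finite_conservative_crl_iso)+

text \<open>Restrictions keep the element type, so the induction stays among algebras over
  \<open>nat\<close>; the tagged sum is brought back to \<open>nat\<close> by the isomorphism in the
  rule \<open>sum\<close>.\<close>

lemma finite_conservative_crl_imp_catalan_nat:
  "finite_conservative_crl A \<Longrightarrow> catalan_nat A"
proof (induction "card (carrier A)" arbitrary: A rule: less_induct)
  case less
  then interpret finite_conservative_crl A by simp
  show ?case
  proof (cases "carrier A = {rbot A}")
    case True
    \<comment> \<open>On a singleton carrier, closure forces the value of every operation.\<close>
    then have "one_element_algebra A"
      using one_closed m_closed rmeet_closed rjoin_closed rimp_closed
      by (auto simp: one_element_algebra_def)
    then show ?thesis by (rule catalan_nat.one_element)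
  next
    case False
    then obtain T U where TU: "T \<subset> carrier A" "U \<subset> carrier A"
      "finite_conservative_crl (restriction A T)" "finite_conservative_crl (restriction A U)"
      "carrier (restriction A T) = T" "carrier (restriction A U) = U"
      and iso: "rlat_iso (catalan_sum (restriction A T) (restriction A U)) A"
      by (rule catalan_decomposition)
    have "catalan_nat (restriction A T)" "catalan_nat (restriction A U)"
      using TU by (auto intro!: less.hyps psubset_card_mono finite_carrier)
    then show ?thesis using iso by (rule catalan_nat.sum)
  qed
qed

text \<open>The operations are transported along an injection of the finite carrier into
  \<open>nat\<close>. The isomorphism from \<open>A\<close> carries the laws over to
  \<open>N\<close>, and the one back to \<open>A\<close> is what \<open>catalan\<close> asks
  for.\<close>

lemma (in finite_conservative_crl) ex_nat_copy:
  obtains N :: "nat rlat" where "rlat_iso A N" "rlat_iso N A"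
proof -
  obtain f :: "'a \<Rightarrow> nat" where f: "inj_on f (carrier A)"
    using finite_carrier finite_imp_inj_to_nat_seg by metis
  define g where "g = inv_into (carrier A) f"
  have g: "g (f x) = x" if "x \<in> carrier A" for x using f that by (simp add: g_def)
  define N where "N = \<lparr>carrier = f ` carrier A, mult = \<lambda>x y. f (g x \<otimes> g y), one = f \<one>,
    rmeet = \<lambda>x y. f (rmeet A (g x) (g y)), rjoin = \<lambda>x y. f (rjoin A (g x) (g y)),
    rimp = \<lambda>x y. f (rimp A (g x) (g y))\<rparr>"
  show ?thesis
  proof (rule that)
    show "rlat_iso A N"
      unfolding rlat_iso_def by (intro exI[of _ f]) (simp add: N_def g bij_betw_def f)
    have "bij_betw g (f ` carrier A) (carrier A)"
      using f bij_betw_inv_into[of f "carrier A" "f ` carrier A"] by (simp add: g_def bij_betw_def)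
    then show "rlat_iso N A"
      unfolding rlat_iso_def
      by (intro exI[of _ g]) (simp add: N_def g rmeet_closed rjoin_closed rimp_closed)
  qed
qed

theorem theorem5p5:
  fixes A :: "'a rlat"
  shows "comm_residuated_lattice A \<and> conservative A \<and> finite (carrier A) \<longleftrightarrow> catalan A"
proof -
  have "finite_conservative_crl A \<longleftrightarrow> catalan A"
  proof
    assume A: "finite_conservative_crl A"
    then obtain N :: "nat rlat" where "rlat_iso A N" "rlat_iso N A"
      by (rule finite_conservative_crl.ex_nat_copy)
    then show "catalan A"
      unfolding catalan_def
      using A finite_conservative_crl_iso finite_conservative_crl_imp_catalan_nat by blast
  next
    assume "catalan A"
    then show "finite_conservative_crl A"
      unfolding catalan_def
      using catalan_nat_imp_finite_conservative_crl finite_conservative_crl_iso by blast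
  qed
  then show ?thesis
    by (simp add: finite_conservative_crl_def finite_conservative_crl_axioms_def)
qed

end
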